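(* Let $n\ge 1$, let $J_n$ be an $n\times n$ complex irreducible tridiagonal matrix with zero main diagonal, with subdiagonal entries $a_1,\dots,a_{n-1}\in\mathbb{C}\setminus\{0\}$ and superdiagonal entries $c_1,\dots,c_{n-1}\in\mathbb{C}\setminus\{0\}$. Let $x\in\mathbb{C}\setminus\{0\}$ and $A_n=J_n+xE_n$, where $E_n=\mathrm{diag}(1,-1,1,\dots,(-1)^{n-1})$. For each eigenvalue $\lambda$ of $J_n$ let $u_0^{(\lambda)},u_1^{(\lambda)},\dots$ denote the eigenvector and generalised eigenvectors of $J_n$ for $\lambda$, chosen so that $u_j^{(-\lambda)}=(-1)^jE_nu_j^{(\lambda)}$ for all $j$ (see context). Then the following vectors are eigenvectors $v_0^{(\mu)}$ and first generalised eigenvectors $v_1^{(\mu)}$ of $A_n$, that is, $v_0^{(\mu)}\ne 0$, $A_nv_0^{(\mu)}=\mu v_0^{(\mu)}$ and $A_nv_1^{(\mu)}=\mu v_1^{(\mu)}+v_0^{(\mu)}$. 1) If $0$ is an eigenvalue of $J_n$, then for $\mu=x$ one can take $v_0^{(x)}=u_0^{(0)}$; if moreover $0$ is an eigenvalue of $J_n$ of algebraic multiplicity at least $3$, then one can take $v_1^{(x)}=u_1^{(0)}+2x\,u_2^{(0)}$. 2) If $0$ is an eigenvalue of $J_n$ of algebraic multiplicity at least $3$, then for $\mu=-x$ one can take $v_0^{(-x)}=u_0^{(0)}-2x\,u_1^{(0)}$; if this multiplicity is at least $5$, then one can take $v_1^{(-x)}=u_1^{(0)}-2x\,u_2^{(0)}+4x^2u_3^{(0)}$.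 3) If $\lambda_j\neq 0$ is an eigenvalue of $J_n$ and $x=\pm i\lambda_j$, then for $\mu=0$ one can take (with the corresponding choice of signs) $$v_0^{(0)}=u_0^{(\lambda_j)}\pm i\,u_0^{(-\lambda_j)},\qquad v_1^{(0)}=\frac{u_0^{(\lambda_j)}\mp i\,u_0^{(-\lambda_j)}}{2\lambda_j}.$$ 4) If $\lambda_k\ne 0$ is an eigenvalue of $J_n$ and $\mu$ is any fixed complex square root of $x^2+\lambda_k^2$, then one can take $$v_0^{(\mu)}=u_0^{(\lambda_k)}+\frac{x}{\lambda_k+\mu}u_0^{(-\lambda_k)},\qquad v_0^{(-\mu)}=u_0^{(-\lambda_k)}-\frac{x}{\lambda_k+\mu}u_0^{(\lambda_k)};$$ if moreover $\lambda_k$ is a multiple eigenvalue of $J_n$, then (together with these $v_0^{(\pm\mu)}$) one can take $$v_1^{(\mu)}=\frac1{2\lambda_k}\left(u_0^{(\lambda_k)}-\frac{x}{\lambda_k+\mu}u_0^{(-\lambda_k)}\right)+\frac{\mu}{\lambda_k}\left(u_1^{(\lambda_k)}-\frac{x}{\lambda_k+\mu}u_1^{(-\lambda_k)}\right),$$ $$v_1^{(-\mu)}=-\frac1{2\lambda_k}\left(\frac{x}{\lambda_k+\mu}u_0^{(\lambda_k)}+u_0^{(-\lambda_k)}\right)+\frac{\mu}{\lambda_k}\left(\frac{x}{\lambda_k+\mu}u_1^{(\lambda_k)}+u_1^{(-\lambda_k)}\right).$$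
   Context: $J_n$ has entries $(J_n)_{k+1,k}=a_k$, $(J_n)_{k,k+1}=c_k$ for $k=1,\dots,n-1$, and all other entries zero. For an eigenvalue $\lambda$ of $J_n$ of algebraic multiplicity $m$ (every eigenvalue of $J_n$ is geometrically simple), the eigenvector $u_0^{(\lambda)}\neq0$ and the generalised eigenvectors $u_1^{(\lambda)},\dots,u_{m-1}^{(\lambda)}$ form a Jordan chain: $(J_n-\lambda I_n)u_0^{(\lambda)}=0$ and $(J_n-\lambda I_n)u_j^{(\lambda)}=u_{j-1}^{(\lambda)}$ for $j=1,\dots,m-1$. The spectrum of $J_n$ is symmetric with respect to $0$, with equal multiplicities of $\lambda$ and $-\lambda$. Normalisation convention: the chains are chosen so that $u_j^{(-\lambda)}=(-1)^jE_nu_j^{(\lambda)}$ for all $j$; for $\lambda=0$ this means $E_nu_j^{(0)}=(-1)^ju_j^{(0)}$, i.e. the even-indexed components of $u_j^{(0)}$ vanish for even $j$ and the odd-indexed components vanish for odd $j$. The zero eigenvalue of $J_n$ can occur only for odd $n$. *)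

theory Defs
  imports Complex_Main "Jordan_Normal_Form.Char_Poly"
begin

text \<open>
  Matrix positions are 0-based in the library, while the entries \<open>a k\<close>, \<open>c k\<close> keep the
  1-based index \<open>k = 1, \<dots>, n - 1\<close>: \<open>a k\<close> is the 1-based entry \<open>(k + 1, k)\<close>, i.e. the
  0-based entry \<open>(k, k - 1)\<close>, and \<open>c k\<close> is the 0-based entry \<open>(k - 1, k)\<close>.
\<close>

definition tridiag_zero :: "nat \<Rightarrow> (nat \<Rightarrow> complex) \<Rightarrow> (nat \<Rightarrow> complex) \<Rightarrow> complex mat" where
  "tridiag_zero n a c =
     mat n n (\<lambda>(i, j). if i = Suc j then a i else if j = Suc i then c j else 0)"

definition alt_mat :: "nat \<Rightarrow> complex mat" where
  "alt_mat n = mat_diag n (\<lambda>i. (- 1) ^ i)"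

definition alg_mult :: "complex mat \<Rightarrow> complex \<Rightarrow> nat" where
  "alg_mult A l = order l (char_poly A)"

definition jordan_chain :: "complex mat \<Rightarrow> complex \<Rightarrow> nat \<Rightarrow> (nat \<Rightarrow> complex vec) \<Rightarrow> bool" where
  "jordan_chain A l m w \<longleftrightarrow>
     (\<forall>j < m. w j \<in> carrier_vec (dim_row A)) \<and>
     w 0 \<noteq> 0\<^sub>v (dim_row A) \<and>
     (A - l \<cdot>\<^sub>m 1\<^sub>m (dim_row A)) *\<^sub>v w 0 = 0\<^sub>v (dim_row A) \<and>
     (\<forall>j. 1 \<le> j \<and> j < m \<longrightarrow>
        (A - l \<cdot>\<^sub>m 1\<^sub>m (dim_row A)) *\<^sub>v w j = w (j - 1))"

text \<open>
  A choice, for every eigenvalue \<open>l\<close> of \<open>J\<close>, of a Jordan chain \<open>u l 0, u l 1, \<dots>\<close> whose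
  length is the algebraic multiplicity of \<open>l\<close>, such that the chains for \<open>l\<close> and \<open>- l\<close> are
  related by \<open>E\<close>. The case \<open>l = 0\<close> is included and expresses \<open>E u\<^sub>j = (- 1)\<^sup>j u\<^sub>j\<close>.
\<close>

definition normalised_chains ::
  "complex mat \<Rightarrow> complex mat \<Rightarrow> (complex \<Rightarrow> nat \<Rightarrow> complex vec) \<Rightarrow> bool" where
  "normalised_chains J E u \<longleftrightarrow>
     (\<forall>l. eigenvalue J l \<longrightarrow>
        jordan_chain J l (alg_mult J l) (u l) \<and>
        (\<forall>j < alg_mult J l. u (- l) j = (- 1) ^ j \<cdot>\<^sub>v (E *\<^sub>v u l j)))"

definition first_gen_eigenvector ::
  "complex mat \<Rightarrow> complex \<Rightarrow> complex vec \<Rightarrow> complex vec \<Rightarrow> bool" where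
  "first_gen_eigenvector A \<mu> v0 v1 \<longleftrightarrow>
     v1 \<in> carrier_vec (dim_row A) \<and> A *\<^sub>v v1 = \<mu> \<cdot>\<^sub>v v1 + v0"

end

theory Submission
  imports Defs
begin

text \<open>
  \<open>E\<close> is an involution anticommuting with \<open>J\<close>, so it maps a Jordan chain for \<open>l\<close> to one for
  \<open>- l\<close>, up to alternating signs. Hence \<open>J\<close> and \<open>E\<close>, and with them \<open>A = J + x E\<close>, act explicitly on
  the span of the chains for \<open>l\<close> and \<open>- l\<close>; each claim is a computation there. For \<open>l \<noteq> 0\<close> and
  \<open>t = x / (l + \<mu>)\<close> it rests on \<open>t * (l + \<mu>) = x\<close> and \<open>l + x * t = \<mu>\<close>.
\<close>

section \<open>The alternating sign matrix and its anticommutation with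
  \<open>tridiag_zero\<close>\<close>

lemma alt_mat_carrier [simp]: "alt_mat n \<in> carrier_mat n n"
  by (simp add: alt_mat_def)

lemma alt_mat_mult_vec:
  assumes "v \<in> carrier_vec n"
  shows "alt_mat n *\<^sub>v v = vec n (\<lambda>i. (- 1) ^ i * v $ i)"
proof (rule eq_vecI)
  fix i assume i: "i < dim_vec (vec n (\<lambda>i. (- 1) ^ i * v $ i))"
  have "(alt_mat n *\<^sub>v v) $ i = (\<Sum>j\<in>{0..<n}. (if i = j then (- 1) ^ j else 0) * v $ j)"
    using i assms by (auto simp: alt_mat_def mat_diag_def scalar_prod_def intro!: sum.cong)
  also have "\<dots> = (\<Sum>j\<in>{0..<n}. if i = j then (- 1) ^ j * v $ j else 0)"
    by (intro sum.cong) auto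
  also have "\<dots> = (- 1) ^ i * v $ i"
    using i by (subst sum.delta') auto
  finally show "(alt_mat n *\<^sub>v v) $ i = vec n (\<lambda>i. (- 1) ^ i * v $ i) $ i"
    using i by simp
qed (simp add: alt_mat_def mat_diag_def)

lemma alt_mat_involution:
  assumes "v \<in> carrier_vec n"
  shows "alt_mat n *\<^sub>v (alt_mat n *\<^sub>v v) = v"
  using assms by (intro eq_vecI) (auto simp: alt_mat_mult_vec simp flip: mult.assoc power_add)

lemma tridiag_zero_carrier [simp]: "tridiag_zero n a c \<in> carrier_mat n n"
  by (simp add: tridiag_zero_def)

text \<open>An entry of \<open>tridiag_zero\<close> can be non-zero only where row and column index
  differ by one; there \<open>(- 1) ^ j\<close> is the opposite of \<open>(- 1) ^ i\<close>, so
  every term of the sum changes sign.\<close>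

lemma tridiag_zero_alt_mat_anticommute:
  assumes v: "v \<in> carrier_vec n"
  shows "tridiag_zero n a c *\<^sub>v (alt_mat n *\<^sub>v v) = - (alt_mat n *\<^sub>v (tridiag_zero n a c *\<^sub>v v))"
proof (rule eq_vecI)
  let ?J = "tridiag_zero n a c"
  have Jv: "?J *\<^sub>v v \<in> carrier_vec n"
    using v by (rule mult_mat_vec_carrier[OF tridiag_zero_carrier])
  fix i assume "i < dim_vec (- (alt_mat n *\<^sub>v (?J *\<^sub>v v)))"
  then have i: "i < n"
    by (simp add: alt_mat_def mat_diag_def)
  have "(?J *\<^sub>v (alt_mat n *\<^sub>v v)) $ i = (\<Sum>j\<in>{0..<n}. ?J $$ (i, j) * ((- 1) ^ j * v $ j))"
    using i v by (auto simp: alt_mat_mult_vec scalar_prod_def tridiag_zero_def)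
  also have "\<dots> = (\<Sum>j\<in>{0..<n}. - ((- 1) ^ i * (?J $$ (i, j) * v $ j)))"
    using i by (intro sum.cong) (auto simp: tridiag_zero_def)
  also have "\<dots> = - ((- 1) ^ i * (?J *\<^sub>v v) $ i)"
    using i v by (simp add: scalar_prod_def tridiag_zero_def sum_negf sum_distrib_left)
  also have "\<dots> = (- (alt_mat n *\<^sub>v (?J *\<^sub>v v))) $ i"
    using i Jv by (simp add: alt_mat_mult_vec)
  finally show "(?J *\<^sub>v (alt_mat n *\<^sub>v v)) $ i = (- (alt_mat n *\<^sub>v (?J *\<^sub>v v))) $ i" .
qed (simp add: tridiag_zero_def alt_mat_def mat_diag_def)

section \<open>Jordan chains and eigenvectors for opposite eigenvalues\<close>

lemma alg_mult_pos:
  assumes "J \<in> carrier_mat n n" "eigenvalue J l"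
  shows "0 < alg_mult J l"
  using assms eigenvalue_root_char_poly[OF assms(1), of l]
    degree_monic_char_poly[OF assms(1)]
  by (auto simp: alg_mult_def order_root)

lemma mat_mult_zero_vec:
  fixes M :: "'a :: semiring_0 mat"
  assumes "M \<in> carrier_mat m n"
  shows "M *\<^sub>v 0\<^sub>v n = 0\<^sub>v m"
  using assms by (intro eq_vecI) auto

lemma smult_mat_mult_vec:
  fixes M :: "'a :: comm_ring_1 mat"
  assumes "M \<in> carrier_mat m n" "v \<in> carrier_vec n"
  shows "(k \<cdot>\<^sub>m M) *\<^sub>v v = k \<cdot>\<^sub>v (M *\<^sub>v v)"
  using assms
  by (intro eq_vecI) (auto simp: scalar_prod_def sum_distrib_left mult.assoc intro!: sum.cong)

lemma shifted_mult_vec: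
  fixes J :: "'a :: comm_ring_1 mat"
  assumes "J \<in> carrier_mat n n" "v \<in> carrier_vec n"
  shows "(J - l \<cdot>\<^sub>m 1\<^sub>m n) *\<^sub>v v = J *\<^sub>v v - l \<cdot>\<^sub>v v"
  using assms by (simp add: minus_mult_distrib_mat_vec smult_mat_mult_vec[of _ n n])

lemma vec_eq_add_if_diff_eq:
  fixes v w z :: "'a :: ab_group_add vec"
  assumes "v \<in> carrier_vec n" "w \<in> carrier_vec n" "v - w = z"
  shows "v = w + z"
  using assms by (intro eq_vecI) auto

text \<open>Turns the relations for \<open>J - l I\<close> into formulas for the action of
  \<open>J\<close>. The condition \<open>0 < m\<close>, supplied for eigenvalues by
  \<open>alg_mult_pos\<close>, brings \<open>w 0\<close> under the carrier clause of the
  chain.\<close>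

lemma jordan_chainD:
  assumes J: "J \<in> carrier_mat n n" and ch: "jordan_chain J l m w" and "0 < m"
  shows jordan_chain_nonzero: "w 0 \<noteq> 0\<^sub>v n"
    and jordan_chain_carrier: "j < m \<Longrightarrow> w j \<in> carrier_vec n"
    and jordan_chain_0: "J *\<^sub>v w 0 = l \<cdot>\<^sub>v w 0"
    and jordan_chain_Suc: "Suc j < m \<Longrightarrow> J *\<^sub>v w (Suc j) = l \<cdot>\<^sub>v w (Suc j) + w j"
proof -
  have d: "dim_row J = n"
    using J by simp
  show w0: "w 0 \<noteq> 0\<^sub>v n" and car: "j < m \<Longrightarrow> w j \<in> carrier_vec n" for j
    using ch d by (auto simp: jordan_chain_def)
  have "J *\<^sub>v w 0 - l \<cdot>\<^sub>v w 0 = 0\<^sub>v n"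
    using ch d shifted_mult_vec[OF J car[OF \<open>0 < m\<close>]] by (simp add: jordan_chain_def)
  then have "J *\<^sub>v w 0 = l \<cdot>\<^sub>v w 0 + 0\<^sub>v n"
    using J car[OF \<open>0 < m\<close>] by (intro vec_eq_add_if_diff_eq) auto
  then show "J *\<^sub>v w 0 = l \<cdot>\<^sub>v w 0"
    using car[OF \<open>0 < m\<close>] by simp
  show "J *\<^sub>v w (Suc j) = l \<cdot>\<^sub>v w (Suc j) + w j" if j: "Suc j < m" for j
  proof (rule vec_eq_add_if_diff_eq)
    show "J *\<^sub>v w (Suc j) - l \<cdot>\<^sub>v w (Suc j) = w j"
      using ch d j shifted_mult_vec[OF J car[OF j]]
      by (auto simp: jordan_chain_def dest: spec[of _ "Suc j"])
  qed (use J car[OF j] in auto)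
qed

text \<open>If the combination vanished, so would its image under \<open>J\<close>, which is
  \<open>l\<close> times the combination with the sign of \<open>w\<close> reversed. Adding
  \<open>l\<close> times the combination to this image leaves \<open>2 * l\<close> times
  \<open>v\<close>, and \<open>2 * l\<close> is invertible. This makes the candidates of claims 3)
  and 4) non-zero.\<close>

lemma opposite_eigenvectors_independent:
  fixes J :: "'a :: field_char_0 mat"
  assumes J: "J \<in> carrier_mat n n" and v: "v \<in> carrier_vec n" and w: "w \<in> carrier_vec n"
    and Jv: "J *\<^sub>v v = l \<cdot>\<^sub>v v" and Jw: "J *\<^sub>v w = (- l) \<cdot>\<^sub>v w"
    and l: "l \<noteq> 0" and v0: "v \<noteq> 0\<^sub>v n"
  shows "v + t \<cdot>\<^sub>v w \<noteq> 0\<^sub>v n"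
proof
  assume eq: "v + t \<cdot>\<^sub>v w = 0\<^sub>v n"
  have "J *\<^sub>v (v + t \<cdot>\<^sub>v w) = l \<cdot>\<^sub>v v + t \<cdot>\<^sub>v ((- l) \<cdot>\<^sub>v w)"
    using J v w by (simp add: mult_add_distrib_mat_vec[of _ n n] mult_mat_vec[of _ n n] Jv Jw)
  moreover have "J *\<^sub>v (v + t \<cdot>\<^sub>v w) = 0\<^sub>v n"
    using mat_mult_zero_vec[OF J] eq by simp
  ultimately have eq': "l \<cdot>\<^sub>v v + t \<cdot>\<^sub>v ((- l) \<cdot>\<^sub>v w) = 0\<^sub>v n"
    by simp
  have "v $ i = 0" if "i < n" for i
  proof -
    have "v $ i + t * w $ i = 0" "l * v $ i + t * (- l * w $ i) = 0"
      using arg_cong[OF eq, of "\<lambda>z. z $ i"] arg_cong[OF eq', of "\<lambda>z. z $ i"] that v w by auto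
    moreover have "2 * l * v $ i = l * (v $ i + t * w $ i) + (l * v $ i + t * (- l * w $ i))"
      by (simp add: algebra_simps)
    ultimately have "2 * l * v $ i = 0"
      by (simp only: mult_zero_right add_0)
    then show ?thesis
      using l by simp
  qed
  then have "v = 0\<^sub>v n"
    using v by (intro eq_vecI) auto
  with v0 show False ..
qed

section \<open>The action of \<open>J\<close> and of the sign matrix on normalised chains\<close>

text \<open>At index 0 the normalising sign is 1, so the involution \<open>alt_mat n\<close>
  exchanges the two eigenvectors. All facts about \<open>- l\<close> are carried over from
  \<open>l\<close> by this exchange and anticommutation, so the symmetry of the spectrum is not
  presupposed. The case \<open>l = 0\<close> is included.\<close>

lemma normalised_eigenvector:
  assumes J: "J = tridiag_zero n a c" and u: "normalised_chains J (alt_mat n) u"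
    and ev: "eigenvalue J l"
  shows "u l 0 \<in> carrier_vec n" "u (- l) 0 \<in> carrier_vec n"
    "u l 0 \<noteq> 0\<^sub>v n" "u (- l) 0 \<noteq> 0\<^sub>v n"
    "J *\<^sub>v u l 0 = l \<cdot>\<^sub>v u l 0" "J *\<^sub>v u (- l) 0 = (- l) \<cdot>\<^sub>v u (- l) 0"
    "alt_mat n *\<^sub>v u l 0 = u (- l) 0" "alt_mat n *\<^sub>v u (- l) 0 = u l 0"
proof -
  have Jc: "J \<in> carrier_mat n n"
    by (simp add: J)
  note pos = alg_mult_pos[OF Jc ev]
  have ch: "jordan_chain J l (alg_mult J l) (u l)"
    using u ev by (auto simp: normalised_chains_def)
  note D = jordan_chainD[OF Jc ch pos]
  show car: "u l 0 \<in> carrier_vec n" and nz: "u l 0 \<noteq> 0\<^sub>v n" and ev0: "J *\<^sub>v u l 0 = l \<cdot>\<^sub>v u l 0"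
    using D pos by auto
  have "u (- l) 0 = (- 1) ^ 0 \<cdot>\<^sub>v (alt_mat n *\<^sub>v u l 0)"
    using u ev pos unfolding normalised_chains_def by blast
  then show E0: "alt_mat n *\<^sub>v u l 0 = u (- l) 0"
    by simp
  show car': "u (- l) 0 \<in> carrier_vec n"
    using mult_mat_vec_carrier[OF alt_mat_carrier car] by (simp add: E0)
  show E1: "alt_mat n *\<^sub>v u (- l) 0 = u l 0"
    using alt_mat_involution[OF car] by (simp add: E0)
  show "u (- l) 0 \<noteq> 0\<^sub>v n"
  proof
    assume "u (- l) 0 = 0\<^sub>v n"
    then have "u l 0 = 0\<^sub>v n"
      using E1 mat_mult_zero_vec[OF alt_mat_carrier] by simp
    with nz show False ..
  qed
  show "J *\<^sub>v u (- l) 0 = (- l) \<cdot>\<^sub>v u (- l) 0"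
    using tridiag_zero_alt_mat_anticommute[OF car, of a c] car car' ev0
    by (auto simp: J E0 mult_mat_vec[OF alt_mat_carrier] intro!: eq_vecI)
qed

text \<open>Anticommutation negates both terms of the chain relation for \<open>l\<close>. In the
  first term this turns \<open>l\<close> into \<open>- l\<close>; in the second it is compensated by
  the normalising signs at \<open>Suc j\<close> and \<open>j\<close>, which are opposite. So the
  relation for \<open>- l\<close> again has \<open>+ u (- l) j\<close>.\<close>

lemma normalised_gen_eigenvector:
  assumes J: "J = tridiag_zero n a c" and u: "normalised_chains J (alt_mat n) u"
    and ev: "eigenvalue J l" and j: "Suc j < alg_mult J l"
  shows "u l (Suc j) \<in> carrier_vec n"
    "u (- l) (Suc j) \<in> carrier_vec n"
    "J *\<^sub>v u l (Suc j) = l \<cdot>\<^sub>v u l (Suc j) + u l j"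
    "J *\<^sub>v u (- l) (Suc j) = (- l) \<cdot>\<^sub>v u (- l) (Suc j) + u (- l) j"
    "alt_mat n *\<^sub>v u l (Suc j) = (- 1) ^ Suc j \<cdot>\<^sub>v u (- l) (Suc j)"
    "alt_mat n *\<^sub>v u (- l) (Suc j) = (- 1) ^ Suc j \<cdot>\<^sub>v u l (Suc j)"
proof -
  have Jc: "J \<in> carrier_mat n n"
    by (simp add: J)
  note pos = alg_mult_pos[OF Jc ev]
  have ch: "jordan_chain J l (alg_mult J l) (u l)"
    using u ev by (auto simp: normalised_chains_def)
  note D = jordan_chainD[OF Jc ch pos]
  have car: "u l i \<in> carrier_vec n" if "i \<le> Suc j" for i
    using D j that by auto
  have Ecar: "alt_mat n *\<^sub>v u l i \<in> carrier_vec n" if "i \<le> Suc j" for i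
    using mult_mat_vec_carrier[OF alt_mat_carrier car[OF that]] .
  have neg: "u (- l) i = (- 1) ^ i \<cdot>\<^sub>v (alt_mat n *\<^sub>v u l i)" if "i \<le> Suc j" for i
    using u ev j that unfolding normalised_chains_def by (meson le_less_trans)
  show cSj: "u l (Suc j) \<in> carrier_vec n"
    using car by blast
  show "u (- l) (Suc j) \<in> carrier_vec n"
    using neg Ecar by simp
  show JS: "J *\<^sub>v u l (Suc j) = l \<cdot>\<^sub>v u l (Suc j) + u l j"
    using D(4) j .
  show "alt_mat n *\<^sub>v u l (Suc j) = (- 1) ^ Suc j \<cdot>\<^sub>v u (- l) (Suc j)"
    using Ecar[of "Suc j"] by (simp add: neg smult_smult_assoc flip: power_add mult_2)
  show "alt_mat n *\<^sub>v u (- l) (Suc j) = (- 1) ^ Suc j \<cdot>\<^sub>v u l (Suc j)"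
    by (simp add: neg mult_mat_vec[OF alt_mat_carrier Ecar] alt_mat_involution[OF cSj])
  have "J *\<^sub>v (alt_mat n *\<^sub>v u l (Suc j))
      = - (l \<cdot>\<^sub>v (alt_mat n *\<^sub>v u l (Suc j)) + alt_mat n *\<^sub>v u l j)"
    using tridiag_zero_alt_mat_anticommute[OF cSj, of a c] JS car[of j] cSj
    by (simp add: J mult_add_distrib_mat_vec[OF alt_mat_carrier] mult_mat_vec[OF alt_mat_carrier])
  then show "J *\<^sub>v u (- l) (Suc j) = (- l) \<cdot>\<^sub>v u (- l) (Suc j) + u (- l) j"
    using Ecar[of j] Ecar[of "Suc j"]
    by (auto simp: neg mult_mat_vec[OF Jc Ecar] algebra_simps intro!: eq_vecI)
qed

section \<open>Eigenvectors and first generalised eigenvectors of \<open>A\<close>\<close>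

theorem mainTheorem4:
  fixes n :: nat
    and a c :: "nat \<Rightarrow> complex"
    and x :: complex
    and J E A :: "complex mat"
    and u :: "complex \<Rightarrow> nat \<Rightarrow> complex vec"
  assumes n: "n \<ge> 1"
    and a: "\<forall>k \<in> {1..<n}. a k \<noteq> 0"
    and c: "\<forall>k \<in> {1..<n}. c k \<noteq> 0"
    and x: "x \<noteq> 0"
    and J: "J = tridiag_zero n a c"
    and E: "E = alt_mat n"
    and A: "A = J + x \<cdot>\<^sub>m E"
    and u: "normalised_chains J E u"
  shows
    \<comment> \<open>1)\<close>
    "(eigenvalue J 0 \<longrightarrow>
        eigenvector A (u 0 0) x \<and>
        (alg_mult J 0 \<ge> 3 \<longrightarrow>
           first_gen_eigenvector A x (u 0 0) (u 0 1 + (2 * x) \<cdot>\<^sub>v u 0 2)))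
     \<and>
     (eigenvalue J 0 \<and> alg_mult J 0 \<ge> 3 \<longrightarrow>
        eigenvector A (u 0 0 - (2 * x) \<cdot>\<^sub>v u 0 1) (- x) \<and>
        (alg_mult J 0 \<ge> 5 \<longrightarrow>
           first_gen_eigenvector A (- x)
             (u 0 0 - (2 * x) \<cdot>\<^sub>v u 0 1)
             (u 0 1 - (2 * x) \<cdot>\<^sub>v u 0 2 + (4 * x^2) \<cdot>\<^sub>v u 0 3)))
     \<and>
     (\<forall>l. \<forall>s \<in> {1, - 1}. l \<noteq> 0 \<and> eigenvalue J l \<and> x = s * \<i> * l \<longrightarrow>
        eigenvector A (u l 0 + (s * \<i>) \<cdot>\<^sub>v u (- l) 0) 0 \<and>
        first_gen_eigenvector A 0
          (u l 0 + (s * \<i>) \<cdot>\<^sub>v u (- l) 0)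
          ((1 / (2 * l)) \<cdot>\<^sub>v (u l 0 - (s * \<i>) \<cdot>\<^sub>v u (- l) 0)))
     \<and>
     (\<forall>l \<mu>. l \<noteq> 0 \<and> eigenvalue J l \<and> \<mu>^2 = x^2 + l^2 \<longrightarrow>
        eigenvector A (u l 0 + (x / (l + \<mu>)) \<cdot>\<^sub>v u (- l) 0) \<mu> \<and>
        eigenvector A (u (- l) 0 - (x / (l + \<mu>)) \<cdot>\<^sub>v u l 0) (- \<mu>) \<and>
        (alg_mult J l \<ge> 2 \<longrightarrow>
           first_gen_eigenvector A \<mu>
             (u l 0 + (x / (l + \<mu>)) \<cdot>\<^sub>v u (- l) 0)
             ((1 / (2 * l)) \<cdot>\<^sub>v (u l 0 - (x / (l + \<mu>)) \<cdot>\<^sub>v u (- l) 0)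
              + (\<mu> / l) \<cdot>\<^sub>v (u l 1 - (x / (l + \<mu>)) \<cdot>\<^sub>v u (- l) 1)) \<and>
           first_gen_eigenvector A (- \<mu>)
             (u (- l) 0 - (x / (l + \<mu>)) \<cdot>\<^sub>v u l 0)
             ((- (1 / (2 * l))) \<cdot>\<^sub>v ((x / (l + \<mu>)) \<cdot>\<^sub>v u l 0 + u (- l) 0)
              + (\<mu> / l) \<cdot>\<^sub>v ((x / (l + \<mu>)) \<cdot>\<^sub>v u l 1 + u (- l) 1))))"
proof -
  have Jc: "J \<in> carrier_mat n n" and Ec: "E \<in> carrier_mat n n" and Ac: "A \<in> carrier_mat n n"
    by (simp_all add: A J E)
  have dA: "dim_row A = n"
    using Ac by simp
  have A_mult: "A *\<^sub>v v = J *\<^sub>v v + x \<cdot>\<^sub>v (E *\<^sub>v v)" if "v \<in> carrier_vec n" for v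
    using that Jc Ec
    by (simp add: A add_mult_distrib_mat_vec[of _ n n] smult_mat_mult_vec[of _ n n])
  note u' = u[unfolded E]
  note eig = normalised_eigenvector[OF J u', folded E]
  note gen = normalised_gen_eigenvector[OF J u', folded E]
  note lin = mult_add_distrib_mat_vec[OF Ac] mult_minus_distrib_mat_vec[OF Ac] mult_mat_vec[OF Ac]
  \<comment> \<open>With these rules and \<open>eq_vecI\<close> the equations for \<open>A\<close>
    become scalar identities between components.\<close>
  note A_simps = first_gen_eigenvector_def eigenvector_def dA lin

  have part1: "eigenvector A (u 0 0) x \<and>
      (alg_mult J 0 \<ge> 3 \<longrightarrow> first_gen_eigenvector A x (u 0 0) (u 0 1 + (2 * x) \<cdot>\<^sub>v u 0 2))"
    if ev: "eigenvalue J 0"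
  proof (intro conjI impI)
    \<comment> \<open>Simplification identifies \<open>- 0\<close> with \<open>0\<close>, so the
      exchange of eigenvectors says that \<open>E\<close> fixes \<open>u 0 0\<close>.\<close>
    note e = eig[OF ev, simplified]
    have A0: "A *\<^sub>v u 0 0 = x \<cdot>\<^sub>v u 0 0"
      using e by (auto simp: A_mult intro!: eq_vecI)
    show "eigenvector A (u 0 0) x"
      using e A0 by (simp add: eigenvector_def dA)
    assume m: "alg_mult J 0 \<ge> 3"
    have g1: "u 0 1 \<in> carrier_vec n" "A *\<^sub>v u 0 1 = u 0 0 + x \<cdot>\<^sub>v (- u 0 1)"
      using gen[OF ev, of 0] m e by (auto simp: A_mult intro!: eq_vecI)
    have g2: "u 0 2 \<in> carrier_vec n" "A *\<^sub>v u 0 2 = u 0 1 + x \<cdot>\<^sub>v u 0 2"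
      using gen[OF ev, of 1] m g1 by (auto simp: A_mult numeral_2_eq_2 intro!: eq_vecI)
    \<comment> \<open>\<open>A - x\<close> sends \<open>u 0 1\<close> to
      \<open>u 0 0 - (2 * x) u 0 1\<close> and \<open>u 0 2\<close> to \<open>u 0 1\<close>; the
      coefficient \<open>2 * x\<close> cancels the unwanted multiple of
      \<open>u 0 1\<close>.\<close>
    show "first_gen_eigenvector A x (u 0 0) (u 0 1 + (2 * x) \<cdot>\<^sub>v u 0 2)"
      using e g1 g2 by (auto simp: A_simps algebra_simps intro!: eq_vecI)
  qed

  have part2: "eigenvector A (u 0 0 - (2 * x) \<cdot>\<^sub>v u 0 1) (- x) \<and>
      (alg_mult J 0 \<ge> 5 \<longrightarrow> first_gen_eigenvector A (- x) (u 0 0 - (2 * x) \<cdot>\<^sub>v u 0 1)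
         (u 0 1 - (2 * x) \<cdot>\<^sub>v u 0 2 + (4 * x^2) \<cdot>\<^sub>v u 0 3))"
    if ev: "eigenvalue J 0" and m: "alg_mult J 0 \<ge> 3"
  proof (intro conjI impI)
    note e = eig[OF ev, simplified]
    have A0: "A *\<^sub>v u 0 0 = x \<cdot>\<^sub>v u 0 0"
      using e by (auto simp: A_mult intro!: eq_vecI)
    have g1: "u 0 1 \<in> carrier_vec n" "A *\<^sub>v u 0 1 = u 0 0 + x \<cdot>\<^sub>v (- u 0 1)"
      "J *\<^sub>v u 0 1 = u 0 0"
      using gen[OF ev, of 0] m e by (auto simp: A_mult intro!: eq_vecI)
    have g2: "u 0 2 \<in> carrier_vec n" "A *\<^sub>v u 0 2 = u 0 1 + x \<cdot>\<^sub>v u 0 2"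
      using gen[OF ev, of 1] m g1 by (auto simp: A_mult numeral_2_eq_2 intro!: eq_vecI)
    \<comment> \<open>Non-vanishing is detected by applying \<open>J\<close>, whose value here is a
      non-zero multiple of \<open>u 0 0\<close>.\<close>
    have "J *\<^sub>v (u 0 0 - (2 * x) \<cdot>\<^sub>v u 0 1) = - ((2 * x) \<cdot>\<^sub>v u 0 0)"
      using e g1 by (auto simp: mult_minus_distrib_mat_vec[OF Jc] mult_mat_vec[OF Jc] intro!: eq_vecI)
    moreover have "- ((2 * x) \<cdot>\<^sub>v u 0 0) \<noteq> 0\<^sub>v n"
    proof
      assume eq: "- ((2 * x) \<cdot>\<^sub>v u 0 0) = 0\<^sub>v n"
      have "u 0 0 $ i = 0" if "i < n" for i
        using arg_cong[OF eq, of "\<lambda>z. z $ i"] that e(1) x by auto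
      then have "u 0 0 = 0\<^sub>v n"
        using e(1) by (intro eq_vecI) auto
      with e show False by simp
    qed
    ultimately have "u 0 0 - (2 * x) \<cdot>\<^sub>v u 0 1 \<noteq> 0\<^sub>v n"
      using mat_mult_zero_vec[OF Jc] by auto
    then show "eigenvector A (u 0 0 - (2 * x) \<cdot>\<^sub>v u 0 1) (- x)"
      using e(1) g1 A0 by (auto simp: A_simps algebra_simps intro!: eq_vecI)
    assume m5: "alg_mult J 0 \<ge> 5"
    have g3: "u 0 3 \<in> carrier_vec n" "A *\<^sub>v u 0 3 = u 0 2 + x \<cdot>\<^sub>v (- u 0 3)"
      using gen[OF ev, of 2] m5 g2 by (auto simp: A_mult numeral_3_eq_3 numeral_2_eq_2 intro!: eq_vecI)
    \<comment> \<open>\<open>A + x\<close> sends \<open>u 0 1\<close> to \<open>u 0 0\<close>,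
      \<open>u 0 2\<close> to \<open>u 0 1 + (2 * x) u 0 2\<close> and \<open>u 0 3\<close> to
      \<open>u 0 2\<close>. The coefficient \<open>- 2 * x\<close> yields the second term of the
      eigenvector, and \<open>4 * x^2\<close> cancels what remains along
      \<open>u 0 2\<close>.\<close>
    show "first_gen_eigenvector A (- x) (u 0 0 - (2 * x) \<cdot>\<^sub>v u 0 1)
         (u 0 1 - (2 * x) \<cdot>\<^sub>v u 0 2 + (4 * x^2) \<cdot>\<^sub>v u 0 3)"
      using e(1) g1 g2 g3
      by (auto simp: A_simps algebra_simps power2_eq_square intro!: eq_vecI)
  qed

  \<comment> \<open>On \<open>u l 0\<close> and \<open>u (- l) 0\<close>, \<open>A\<close> acts by
    the symmetric 2 x 2 matrix with rows \<open>(l, x)\<close> and \<open>(x, - l)\<close>.\<close>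
  have A_pair: "A *\<^sub>v u l 0 = l \<cdot>\<^sub>v u l 0 + x \<cdot>\<^sub>v u (- l) 0"
    "A *\<^sub>v u (- l) 0 = (- l) \<cdot>\<^sub>v u (- l) 0 + x \<cdot>\<^sub>v u l 0" if "eigenvalue J l" for l
    using eig[OF that] by (auto simp: A_mult)

  \<comment> \<open>Here \<open>x^2 + l^2 = 0\<close>, so for \<open>l \<noteq> 0\<close> the 2 x 2
    matrix is nilpotent but not zero. Hence the generalised eigenvector already lies in the span of
    the two eigenvectors, whatever the multiplicity of \<open>l\<close>.\<close>
  have part3: "eigenvector A (u l 0 + (s * \<i>) \<cdot>\<^sub>v u (- l) 0) 0 \<and>
      first_gen_eigenvector A 0 (u l 0 + (s * \<i>) \<cdot>\<^sub>v u (- l) 0)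
        ((1 / (2 * l)) \<cdot>\<^sub>v (u l 0 - (s * \<i>) \<cdot>\<^sub>v u (- l) 0))"
    if s: "s \<in> {1, - 1}" and l: "l \<noteq> 0" and ev: "eigenvalue J l" and xs: "x = s * \<i> * l" for l s
  proof
    note e = eig[OF ev] and p = A_pair[OF ev]
    \<comment> \<open>Both signs are treated at once: only \<open>q * q = - 1\<close> and
      \<open>x = q * l\<close> enter the computation.\<close>
    define q where "q = s * \<i>"
    have q: "q * q = - 1" "x = q * l"
      using s xs by (auto simp: q_def)
    have "u l 0 + q \<cdot>\<^sub>v u (- l) 0 \<noteq> 0\<^sub>v n"
      using opposite_eigenvectors_independent[OF Jc e(1,2,5,6) l e(3)] .
    \<comment> \<open>Here and below, \<open>y\<close> and \<open>z\<close> stand for components of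
      \<open>u l 0\<close> and \<open>u (- l) 0\<close>.\<close>
    moreover have "l * y + x * z + q * (- l * z + x * y) = 0" for y z
    proof -
      have "l * y + x * z + q * (- l * z + x * y) = (1 + q * q) * (l * y)"
        by (simp add: q(2) algebra_simps)
      then show ?thesis
        by (simp add: q(1))
    qed
    ultimately show "eigenvector A (u l 0 + (s * \<i>) \<cdot>\<^sub>v u (- l) 0) 0"
      using e(1,2) p unfolding q_def[symmetric]
      by (auto simp: A_simps add.assoc intro!: eq_vecI)
    have "(l * y + x * z - q * (- l * z + x * y)) / (2 * l) = y + q * z" for y z
    proof -
      have "l * y + x * z - q * (- l * z + x * y) = (1 - q * q) * (l * y) + 2 * l * (q * z)"
        by (simp add: q(2) algebra_simps)
      then show ?thesis
        unfolding q(1) using l by (simp add: field_simps)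
    qed
    then show "first_gen_eigenvector A 0 (u l 0 + (s * \<i>) \<cdot>\<^sub>v u (- l) 0)
        ((1 / (2 * l)) \<cdot>\<^sub>v (u l 0 - (s * \<i>) \<cdot>\<^sub>v u (- l) 0))"
      using e(1,2) p unfolding q_def[symmetric]
      by (auto simp: A_simps add.assoc intro!: eq_vecI)
  qed

  have part4: "eigenvector A (u l 0 + (x / (l + \<mu>)) \<cdot>\<^sub>v u (- l) 0) \<mu> \<and>
      eigenvector A (u (- l) 0 - (x / (l + \<mu>)) \<cdot>\<^sub>v u l 0) (- \<mu>) \<and>
      (alg_mult J l \<ge> 2 \<longrightarrow>
         first_gen_eigenvector A \<mu>
           (u l 0 + (x / (l + \<mu>)) \<cdot>\<^sub>v u (- l) 0)
           ((1 / (2 * l)) \<cdot>\<^sub>v (u l 0 - (x / (l + \<mu>)) \<cdot>\<^sub>v u (- l) 0)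
            + (\<mu> / l) \<cdot>\<^sub>v (u l 1 - (x / (l + \<mu>)) \<cdot>\<^sub>v u (- l) 1)) \<and>
         first_gen_eigenvector A (- \<mu>)
           (u (- l) 0 - (x / (l + \<mu>)) \<cdot>\<^sub>v u l 0)
           ((- (1 / (2 * l))) \<cdot>\<^sub>v ((x / (l + \<mu>)) \<cdot>\<^sub>v u l 0 + u (- l) 0)
            + (\<mu> / l) \<cdot>\<^sub>v ((x / (l + \<mu>)) \<cdot>\<^sub>v u l 1 + u (- l) 1)))"
    if l: "l \<noteq> 0" and ev: "eigenvalue J l" and mu: "\<mu>^2 = x^2 + l^2" for l \<mu>
  proof -
    note e = eig[OF ev] and p = A_pair[OF ev]
    define t where "t = x / (l + \<mu>)"
    \<comment> \<open>Otherwise \<open>\<mu>^2 = l^2\<close>, which forces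
      \<open>x = 0\<close>.\<close>
    have "l + \<mu> \<noteq> 0"
    proof
      assume "l + \<mu> = 0"
      then have "\<mu> = - l"
        by (simp add: eq_neg_iff_add_eq_0 add.commute)
      with mu x show False by simp
    qed
    then have t: "t * (l + \<mu>) = x"
      by (simp add: t_def)
    then have "(l + x * t) * (l + \<mu>) = l * (l + \<mu>) + x * x"
      by (metis distrib_right mult.assoc)
    also have "\<dots> = \<mu> * (l + \<mu>)"
      using mu by (simp add: algebra_simps power2_eq_square)
    finally have xt: "l + x * t = \<mu>"
      using \<open>l + \<mu> \<noteq> 0\<close> by simp
    \<comment> \<open>Together with \<open>xt\<close> this says that \<open>(1, t)\<close> is an
      eigenvector for \<open>\<mu>\<close> of the 2 x 2 matrix above; by symmetry
      \<open>(- t, 1)\<close> is one for \<open>- \<mu>\<close>.\<close>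
    have tl: "x - t * l = t * \<mu>"
      by (simp add: algebra_simps flip: t)
    define r where "r = 1 / (2 * l)"
    define k where "k = \<mu> / l"
    \<comment> \<open>\<open>rk1\<close> and \<open>rk2\<close> compare the coefficients of
      \<open>u l 0\<close> and \<open>u (- l) 0\<close> in the equation for the generalised
      eigenvector. Both reduce to \<open>r * (2 * l) = 1\<close> through \<open>xt\<close> and
      \<open>tl\<close>.\<close>
    have "r * (l - x * t) + k = \<mu> * r + r * (\<mu> + l - x * t)"
      using l by (simp add: r_def k_def field_simps)
    also have "\<dots> = \<mu> * r + 1"
      using l by (simp add: r_def flip: xt)
    finally have rk1: "r * (l - x * t) + k = \<mu> * r + 1" .
    have "r * (x + t * l) - k * t = r * (x + t * l - t * \<mu>) - \<mu> * r * t"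
      using l by (simp add: r_def k_def field_simps)
    also have "\<dots> = t - \<mu> * r * t"
      using l by (simp add: r_def flip: tl)
    finally have rk2: "r * (x + t * l) - k * t = t - \<mu> * r * t" .
    have "u l 0 + t \<cdot>\<^sub>v u (- l) 0 \<noteq> 0\<^sub>v n"
      using opposite_eigenvectors_independent[OF Jc e(1,2,5,6) l e(3)] .
    moreover have "l * y + x * z + t * (- l * z + x * y) = \<mu> * (y + t * z)" for y z
    proof -
      have "l * y + x * z + t * (- l * z + x * y)
          = (l + x * t) * y + (x - t * l) * z"
        by (simp add: algebra_simps)
      then show ?thesis
        unfolding xt tl by (simp add: algebra_simps)
    qed
    ultimately have eig_pos: "eigenvector A (u l 0 + t \<cdot>\<^sub>v u (- l) 0) \<mu>"
      using e(1,2) p by (auto simp: A_simps add.assoc intro!: eq_vecI)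
    have "u (- l) 0 + (- t) \<cdot>\<^sub>v u l 0 \<noteq> 0\<^sub>v n"
      using opposite_eigenvectors_independent[OF Jc e(2,1,6) _ _ e(4)] e(5) l by simp
    moreover have "u (- l) 0 + (- t) \<cdot>\<^sub>v u l 0 = u (- l) 0 - t \<cdot>\<^sub>v u l 0"
      using e(1,2) by (intro eq_vecI) auto
    moreover have "- l * z + x * y - t * (l * y + x * z) = - \<mu> * (z - t * y)" for y z
    proof -
      have "- l * z + x * y - t * (l * y + x * z)
          = (x - t * l) * y - (l + x * t) * z"
        by (simp add: algebra_simps)
      then show ?thesis
        unfolding xt tl by (simp add: algebra_simps)
    qed
    ultimately have eig_neg: "eigenvector A (u (- l) 0 - t \<cdot>\<^sub>v u l 0) (- \<mu>)"
      using e(1,2) p by (auto simp: A_simps add.assoc intro!: eq_vecI)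
    have gen_both: "first_gen_eigenvector A \<mu> (u l 0 + t \<cdot>\<^sub>v u (- l) 0)
           (r \<cdot>\<^sub>v (u l 0 - t \<cdot>\<^sub>v u (- l) 0) + k \<cdot>\<^sub>v (u l 1 - t \<cdot>\<^sub>v u (- l) 1)) \<and>
         first_gen_eigenvector A (- \<mu>) (u (- l) 0 - t \<cdot>\<^sub>v u l 0)
           ((- r) \<cdot>\<^sub>v (t \<cdot>\<^sub>v u l 0 + u (- l) 0) + k \<cdot>\<^sub>v (t \<cdot>\<^sub>v u l 1 + u (- l) 1))"
      if m: "alg_mult J l \<ge> 2"
    proof
      have "Suc 0 < alg_mult J l"
        using m by simp
      note g = gen[OF ev this, folded One_nat_def, simplified]
      \<comment> \<open>At index 1 the normalising sign is \<open>- 1\<close>, so \<open>x\<close>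
        acts as \<open>- x\<close>. The matching eigenvectors are \<open>(1, - t)\<close> for
        \<open>\<mu>\<close> and \<open>(t, 1)\<close> for \<open>- \<mu>\<close>, whence the
        changed signs of \<open>t\<close> in the claim.\<close>
      have A1: "A *\<^sub>v u l 1 = l \<cdot>\<^sub>v u l 1 + u l 0 + x \<cdot>\<^sub>v (- u (- l) 1)"
        "A *\<^sub>v u (- l) 1 = (- l) \<cdot>\<^sub>v u (- l) 1 + u (- l) 0 + x \<cdot>\<^sub>v (- u l 1)"
        using g by (auto simp: A_mult)
      \<comment> \<open>The primed variables are components of \<open>u l 1\<close> and
        \<open>u (- l) 1\<close>. Collecting terms by component exposes the left-hand sides of
        \<open>rk1\<close>, \<open>rk2\<close>, \<open>xt\<close> and \<open>tl\<close>.\<close>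
      have "r * (l * y + x * z - t * (- l * z + x * y))
          + k * (l * y' + (y + x * (- z')) - t * (- l * z' + (z + x * (- y'))))
        = \<mu> * (r * (y - t * z) + k * (y' - t * z')) + (y + t * z)" for y z y' z'
      proof -
        have "r * (l * y + x * z - t * (- l * z + x * y))
            + k * (l * y' + (y + x * (- z')) - t * (- l * z' + (z + x * (- y'))))
            = (r * (l - x * t) + k) * y + (r * (x + t * l) - k * t) * z
              + k * ((l + x * t) * y' - (x - t * l) * z')"
          by (simp add: algebra_simps)
        then show ?thesis
          unfolding rk1 rk2 xt tl by (simp add: algebra_simps)
      qed
      then show "first_gen_eigenvector A \<mu> (u l 0 + t \<cdot>\<^sub>v u (- l) 0)
           (r \<cdot>\<^sub>v (u l 0 - t \<cdot>\<^sub>v u (- l) 0) + k \<cdot>\<^sub>v (u l 1 - t \<cdot>\<^sub>v u (- l) 1))"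
        using e(1,2) p g(1,2) A1 by (auto simp: A_simps add.assoc intro!: eq_vecI)
      \<comment> \<open>The same four relations suffice for \<open>- \<mu>\<close>:
        \<open>rk1\<close> now gives the coefficient of \<open>z\<close>, and \<open>rk2\<close>
        with a minus sign that of \<open>y\<close>.\<close>
      have "- r * (t * (l * y + x * z) + (- l * z + x * y))
          + k * (t * (l * y' + (y + x * (- z'))) + (- l * z' + (z + x * (- y'))))
        = - \<mu> * (- r * (t * y + z) + k * (t * y' + z')) + (z - t * y)" for y z y' z'
      proof -
        have "- r * (t * (l * y + x * z) + (- l * z + x * y))
            + k * (t * (l * y' + (y + x * (- z'))) + (- l * z' + (z + x * (- y'))))
            = - (r * (x + t * l) - k * t) * y + (r * (l - x * t) + k) * z
              - k * ((x - t * l) * y' + (l + x * t) * z')"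
          by (simp add: algebra_simps)
        then show ?thesis
          unfolding rk1 rk2 xt tl by (simp add: algebra_simps)
      qed
      then show "first_gen_eigenvector A (- \<mu>) (u (- l) 0 - t \<cdot>\<^sub>v u l 0)
           ((- r) \<cdot>\<^sub>v (t \<cdot>\<^sub>v u l 0 + u (- l) 0) + k \<cdot>\<^sub>v (t \<cdot>\<^sub>v u l 1 + u (- l) 1))"
        using e(1,2) p g(1,2) A1 by (auto simp: A_simps add.assoc intro!: eq_vecI)
    qed
    show ?thesis
      using eig_pos eig_neg gen_both unfolding t_def r_def k_def by blast
  qed

  show ?thesis
    using part1 part2 part3 part4 by blast
qed

end
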